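(* Let $\mathbf{A}_1,\ldots,\mathbf{A}_n$ be $d\times d$ positive semidefinite matrices and let $1\le k\le n$. Then $$\left\| \mathbb{E}_{\mathrm{wo}}\left[ \prod_{i=1}^k \mathbf{A}_{j_i} \right] \right\| \leq d^k \left\| \mathbb{E}_{\mathrm{wr}} \left[ \prod_{i=1}^k \mathbf{A}_{j_i} \right] \right\| .$$
   Context: Matrices are real and positive semidefinite matrices are symmetric; $\|\cdot\|$ is the operator (spectral) norm. For a function $f$ of $k$ matrix arguments and a tuple $(\mathbf{A}_1,\dots,\mathbf{A}_n)$ with $k\le n$, the without-replacement expectation is $$\mathbb{E}_{\mathrm{wo}}[f(\mathbf{A}_{j_1},\ldots,\mathbf{A}_{j_k})]=\frac{(n-k)!}{n!}\sum_{l_1,\dots,l_k \text{ pairwise distinct in }\{1,\dots,n\}} f(\mathbf{A}_{l_1},\ldots,\mathbf{A}_{l_k}),$$ and the with-replacement expectation is $$\mathbb{E}_{\mathrm{wr}}[f(\mathbf{A}_{j_1},\ldots,\mathbf{A}_{j_k})]=n^{-k}\sum_{(l_1,\ldots,l_k)\in\{1,\dots,n\}^k} f(\mathbf{A}_{l_1},\ldots,\mathbf{A}_{l_k}).$$ Product convention: $\prod_{i=1}^k \mathbf{M}_i$ means $\mathbf{M}_k\mathbf{M}_{k-1}\cdots\mathbf{M}_1$. *)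

theory Defs
  imports "HOL-Analysis.Analysis"
begin

definition psd_matrix :: "real^'d^'d \<Rightarrow> bool" where
  "psd_matrix M \<longleftrightarrow> transpose M = M \<and> (\<forall>x. 0 \<le> x \<bullet> (M *v x))"

text \<open>
  The norm that the type \<^typ>\<open>real^'d^'d\<close> carries is the Frobenius norm, so the spectral
  norm is taken from the operator norm of the associated linear map.
\<close>

definition spectral_norm :: "real^'d^'d \<Rightarrow> real" where
  "spectral_norm M = onorm (\<lambda>x. M *v x)"

text \<open>
  The factors are accumulated on the left: \<open>mat_prod [M\<^sub>1, \<dots>, M\<^sub>k] = M\<^sub>k ** \<dots> ** M\<^sub>1\<close>.
\<close>

fun mat_prod :: "(real^'d^'d) list \<Rightarrow> real^'d^'d" where
  "mat_prod [] = mat 1"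
| "mat_prod (M # Ms) = mat_prod Ms ** M"

text \<open>
  A function of \<open>k\<close> matrix arguments is a function on lists, applied to lists of length \<open>k\<close> only;
  of the family \<open>A\<close> only \<open>A 1, \<dots>, A n\<close> are used. In the first definition \<open>n - k\<close> is
  truncated subtraction, so it is meaningful for \<open>k \<le> n\<close> only.
\<close>

definition expectation_wo ::
  "nat \<Rightarrow> nat \<Rightarrow> (nat \<Rightarrow> 'm) \<Rightarrow> ('m list \<Rightarrow> 'b) \<Rightarrow> 'b::real_vector" where
  "expectation_wo n k A f =
     (fact (n - k) / fact n) *\<^sub>R
       (\<Sum>l | length l = k \<and> set l \<subseteq> {1..n} \<and> distinct l. f (map A l))"

definition expectation_wr ::
  "nat \<Rightarrow> nat \<Rightarrow> (nat \<Rightarrow> 'm) \<Rightarrow> ('m list \<Rightarrow> 'b) \<Rightarrow> 'b::real_vector" where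
  "expectation_wr n k A f =
     (1 / real n ^ k) *\<^sub>R
       (\<Sum>l | length l = k \<and> set l \<subseteq> {1..n}. f (map A l))"

end

theory Submission
  imports Defs "HOL-Combinatorics.Multiset_Permutations"
begin

text \<open>
  The spectral norm of a positive semidefinite matrix is at most its trace, so the left-hand side
  is at most the without-replacement average of \<open>\<Prod>\<^sub>i trace (A\<^bsub>j\<^sub>i\<^esub>)\<close>, that is, a normalised
  elementary symmetric polynomial in the traces. By Maclaurin's inequality this is at most
  \<open>(trace S / n)\<^sup>k\<close> with \<open>S = A\<^sub>1 + \<dots> + A\<^sub>n\<close>. The with-replacement expectation is \<open>(S / n)\<^sup>k\<close>, and
  log-convexity of the moments \<open>m \<mapsto> e\<^sub>i \<bullet> S\<^sup>m e\<^sub>i\<close> bounds every diagonal entry of \<open>S\<close> by the \<open>k\<close>-th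
  root of the spectral norm of \<open>S\<^sup>k\<close>; summing over the \<open>d\<close> diagonal entries gives the claim.
\<close>

section \<open>Maclaurin's inequality\<close>

text \<open>Convexity: the graph of a power lies above its tangent at \<open>b\<close>. Multiplying
  the bound by \<open>a\<close> carries it to the next exponent, up to a nonnegative multiple of
  \<open>(a - b)\<^sup>2\<close>.\<close>

lemma power_ge_tangent:
  fixes a b :: real
  assumes "0 \<le> a" "0 \<le> b"
  shows "b ^ Suc k + real (Suc k) * b ^ k * (a - b) \<le> a ^ Suc k"
proof (induction k)
  case 0
  then show ?case by simp
next
  case (Suc k)
  have "0 \<le> real (Suc k) * b ^ k * (a - b)\<^sup>2"
    using assms by simp
  then have "b ^ Suc (Suc k) + real (Suc (Suc k)) * b ^ Suc k * (a - b)
      \<le> a * (b ^ Suc k + real (Suc k) * b ^ k * (a - b))"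
    by (simp add: algebra_simps power2_eq_square)
  also have "\<dots> \<le> a * a ^ Suc k"
    by (intro mult_left_mono Suc.IH assms)
  finally show ?case by simp
qed

definition elem_sym :: "nat \<Rightarrow> 'a set \<Rightarrow> ('a \<Rightarrow> real) \<Rightarrow> real" where
  "elem_sym k S f = (\<Sum>X | X \<subseteq> S \<and> card X = k. \<Prod>i\<in>X. f i)"

lemma elem_sym_0: "finite S \<Longrightarrow> elem_sym 0 S f = 1"
proof -
  assume "finite S"
  then have "{X. X \<subseteq> S \<and> card X = 0} = {{}}"
    by (auto dest: finite_subset)
  then show ?thesis
    by (simp add: elem_sym_def)
qed

text \<open>Subsets are sorted by whether they contain \<open>a\<close>; deleting \<open>a\<close>
  maps those that do bijectively onto the subsets of \<open>S\<close> of size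
  \<open>k\<close>.\<close>

lemma elem_sym_insert:
  assumes "finite S" "a \<notin> S"
  shows "elem_sym (Suc k) (insert a S) f = elem_sym (Suc k) S f + f a * elem_sym k S f"
proof -
  let ?P = "\<lambda>k. {X. X \<subseteq> S \<and> card X = k}"
  have fin: "finite (?P k)" for k
    using assms by simp
  have finX: "finite X" if "X \<in> ?P j" for X j
    using that assms(1) by (auto dest: finite_subset)
  have split: "{X. X \<subseteq> insert a S \<and> card X = Suc k} = ?P (Suc k) \<union> insert a ` ?P k"
  proof (intro set_eqI iffI)
    fix X assume X: "X \<in> {X. X \<subseteq> insert a S \<and> card X = Suc k}"
    show "X \<in> ?P (Suc k) \<union> insert a ` ?P k"
    proof (cases "a \<in> X")
      case True
      then have "X = insert a (X - {a})" "X - {a} \<in> ?P k"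
        using X by auto
      then show ?thesis by blast
    next
      case False
      then have "X \<subseteq> S"
        using X by blast
      then show ?thesis
        using X by blast
    qed
  next
    fix X assume "X \<in> ?P (Suc k) \<union> insert a ` ?P k"
    then consider "X \<in> ?P (Suc k)" | Y where "Y \<in> ?P k" "X = insert a Y"
      by blast
    then show "X \<in> {X. X \<subseteq> insert a S \<and> card X = Suc k}"
    proof cases
      case (2 Y)
      then have "a \<notin> Y" "finite Y" "Y \<subseteq> S" "card Y = k"
        using assms(2) finX by blast+
      then show ?thesis
        using 2(2) by (simp add: subset_insertI2)
    qed blast
  qed
  have inj: "inj_on (insert a) (?P k)"
  proof (rule inj_onI)
    fix X Y assume "X \<in> ?P k" "Y \<in> ?P k" "insert a X = insert a Y"
    moreover from this have "a \<notin> X" "a \<notin> Y"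
      using assms(2) by blast+
    ultimately show "X = Y"
      by (simp add: insert_ident)
  qed
  have "elem_sym (Suc k) (insert a S) f
      = elem_sym (Suc k) S f + (\<Sum>X\<in>insert a ` ?P k. \<Prod>i\<in>X. f i)"
    unfolding elem_sym_def split using assms(2) fin
    by (intro sum.union_disjoint) auto
  also have "(\<Sum>X\<in>insert a ` ?P k. \<Prod>i\<in>X. f i) = (\<Sum>X\<in>?P k. f a * (\<Prod>i\<in>X. f i))"
    unfolding sum.reindex[OF inj] o_def
    using assms(2) finX by (intro sum.cong refl prod.insert) auto
  finally show ?thesis
    by (simp add: elem_sym_def sum_distrib_left)
qed

text \<open>
  The induction adds one element \<open>a\<close> at a time: the tangent inequality for \<open>x\<^sup>k\<close> at the old mean,
  evaluated at the new mean, is exactly the recursion for \<open>elem_sym\<close>.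
\<close>

theorem Maclaurin_inequality:
  assumes "finite S" "\<And>i. i \<in> S \<Longrightarrow> 0 \<le> f i"
  shows "elem_sym k S f \<le> real (card S choose k) * (sum f S / real (card S)) ^ k"
  using assms
proof (induction S arbitrary: k rule: finite_induct)
  case empty
  then show ?case
    by (cases k) (simp_all add: elem_sym_0, simp add: elem_sym_def)
next
  case (insert a S)
  show ?case
  proof (cases k)
    case 0
    then show ?thesis
      using insert by (simp add: elem_sym_0)
  next
    case (Suc j)
    define n where "n = card S"
    define m where "m = sum f S / real n"
    define M where "M = (f a + sum f S) / real (Suc n)"
    have m0: "0 \<le> m" and M0: "0 \<le> M"
      unfolding m_def M_def using insert.prems by (auto intro!: divide_nonneg_nonneg sum_nonneg add_nonneg_nonneg)
    \<comment> \<open>For empty \<open>S\<close> the quotient \<open>m\<close> is 0 by convention,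
      and both sides vanish.\<close>
    have "sum f S = real n * m"
      unfolding m_def n_def using insert.hyps by (cases "S = {}") auto
    then have mM: "real (Suc n) * (M - m) = f a - m"
      unfolding M_def by (simp add: field_simps)
    \<comment> \<open>Absorption identity: it turns the weight of \<open>M - m\<close> into the
      slope factor \<open>Suc j\<close> of the tangent.\<close>
    have chooseR: "real (Suc n choose Suc j) * real (Suc j) = real (Suc n) * real (n choose j)"
      by (metis Suc_times_binomial_eq of_nat_mult)
    have "elem_sym (Suc j) (insert a S) f = elem_sym (Suc j) S f + f a * elem_sym j S f"
      by (rule elem_sym_insert) (use insert.hyps in auto)
    also have "\<dots> \<le> real (n choose Suc j) * m ^ Suc j + f a * (real (n choose j) * m ^ j)"
      unfolding n_def m_def using insert.prems
      by (intro add_mono mult_left_mono insert.IH) auto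
    \<comment> \<open>Pascal's rule, after splitting \<open>f a\<close> as
      \<open>m + (f a - m)\<close>.\<close>
    also have "\<dots> = real (Suc n choose Suc j) * m ^ Suc j + real (n choose j) * m ^ j * (f a - m)"
      by (simp add: algebra_simps)
    also have "\<dots> = real (Suc n choose Suc j) * m ^ Suc j
        + (real (Suc n) * real (n choose j)) * m ^ j * (M - m)"
      by (simp add: mM[symmetric] del: of_nat_Suc)
    also have "\<dots> = real (Suc n choose Suc j) * (m ^ Suc j + real (Suc j) * m ^ j * (M - m))"
      unfolding chooseR[symmetric] by (simp only: distrib_left mult.assoc)
    also have "\<dots> \<le> real (Suc n choose Suc j) * M ^ Suc j"
      by (intro mult_left_mono power_ge_tangent m0 M0) auto
    finally show ?thesis
      using insert.hyps by (simp add: Suc M_def n_def)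
  qed
qed

text \<open>Each subset of size \<open>k\<close> underlies \<open>fact k\<close> distinct lists, all
  with the same product. This connects sampling without replacement to Maclaurin's
  inequality.\<close>

lemma sum_distinct_lists:
  fixes f :: "'a \<Rightarrow> real"
  assumes "finite S"
  shows "(\<Sum>l | length l = k \<and> set l \<subseteq> S \<and> distinct l. prod_list (map f l)) = fact k * elem_sym k S f"
proof -
  let ?L = "{l. length l = k \<and> set l \<subseteq> S \<and> distinct l}"
  let ?P = "{X. X \<subseteq> S \<and> card X = k}"
  have "?L \<subseteq> {l. set l \<subseteq> S \<and> length l = k}"
    by auto
  then have finL: "finite ?L"
    using finite_lists_length_eq[OF assms] finite_subset by blast
  have "(\<Sum>l\<in>?L. prod_list (map f l)) = (\<Sum>l\<in>?L. \<Prod>i\<in>set l. f i)"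
    by (intro sum.cong refl) (simp add: prod.distinct_set_conv_list)
  also have "\<dots> = (\<Sum>X\<in>?P. \<Sum>l\<in>{l \<in> ?L. set l = X}. \<Prod>i\<in>set l. f i)"
    using assms finL by (intro sum.group[symmetric]) (auto simp: distinct_card)
  also have "\<dots> = (\<Sum>X\<in>?P. fact k * (\<Prod>i\<in>X. f i))"
  proof (intro sum.cong refl)
    fix X assume X: "X \<in> ?P"
    then have "{l \<in> ?L. set l = X} = permutations_of_set X"
      by (auto simp: permutations_of_set_def distinct_card)
    moreover have "finite X"
      using X assms finite_subset by blast
    moreover have "(\<Sum>l\<in>permutations_of_set X. \<Prod>i\<in>set l. f i)
        = (\<Sum>l\<in>permutations_of_set X. \<Prod>i\<in>X. f i)"
      by (intro sum.cong refl) (simp add: permutations_of_setD(1))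
    ultimately show "(\<Sum>l\<in>{l \<in> ?L. set l = X}. \<Prod>i\<in>set l. f i) = fact k * (\<Prod>i\<in>X. f i)"
      using X by (simp del: mem_Collect_eq) simp
  qed
  finally show ?thesis
    by (simp add: elem_sym_def sum_distrib_left)
qed

section \<open>Positive semidefinite maps and matrices\<close>

text \<open>The form is nonnegative along the line \<open>x + t *\<^sub>R y\<close>, so this
  quadratic in \<open>t\<close> has nonpositive discriminant. Its leading coefficient may vanish and
  is treated separately.\<close>

lemma psd_Cauchy_Schwarz:
  fixes f :: "'a::real_inner \<Rightarrow> 'a"
  assumes "linear f" and sym: "\<And>x y. x \<bullet> f y = f x \<bullet> y" and psd: "\<And>x. 0 \<le> x \<bullet> f x"
  shows "(x \<bullet> f y)\<^sup>2 \<le> (x \<bullet> f x) * (y \<bullet> f y)"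
proof -
  interpret linear f by fact
  have yx: "y \<bullet> f x = x \<bullet> f y"
    by (metis sym inner_commute)
  have quad: "0 \<le> x \<bullet> f x + 2 * t * (x \<bullet> f y) + t\<^sup>2 * (y \<bullet> f y)" for t
    using psd[of "x + t *\<^sub>R y"]
    by (simp add: add scale inner_add_left inner_add_right yx power2_eq_square algebra_simps)
  show ?thesis
  proof (cases "y \<bullet> f y = 0")
    case True
    have "x \<bullet> f y = 0"
    proof (rule ccontr)
      assume "x \<bullet> f y \<noteq> 0"
      then show False
        \<comment> \<open>This \<open>t\<close> gives the now affine function the value -1.\<close>
        using quad[of "- (x \<bullet> f x + 1) / (2 * (x \<bullet> f y))"] True by (simp add: field_simps)
    qed
    then show ?thesis
      using True by simp
  next
    case False
    then have pos: "0 < y \<bullet> f y"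
      using psd[of y] by simp
    \<comment> \<open>The quadratic at its minimiser, multiplied by \<open>y \<bullet> f y\<close>
      to clear the denominator.\<close>
    have "0 \<le> (y \<bullet> f y) * (x \<bullet> f x + 2 * (- (x \<bullet> f y) / (y \<bullet> f y)) * (x \<bullet> f y)
        + (- (x \<bullet> f y) / (y \<bullet> f y))\<^sup>2 * (y \<bullet> f y))"
      by (intro mult_nonneg_nonneg quad less_imp_le pos)
    also have "\<dots> = (x \<bullet> f x) * (y \<bullet> f y) - (x \<bullet> f y)\<^sup>2"
      using False by (simp add: field_simps power2_eq_square)
    finally show ?thesis by simp
  qed
qed

section \<open>Moments of a positive semidefinite map\<close>

context
  fixes f :: "'a::real_inner \<Rightarrow> 'a"
  assumes lin: "linear f" and sym: "\<And>x y. x \<bullet> f y = f x \<bullet> y" and psd: "\<And>x. 0 \<le> x \<bullet> f x"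
begin

lemma linear_funpow: "linear (f ^^ m)"
proof (induction m)
  case (Suc m)
  then show ?case
    using linear_compose[OF Suc lin] by (simp add: o_def)
qed (simp add: linear_id[unfolded id_def] id_def)

lemma sym_funpow: "x \<bullet> (f ^^ m) y = (f ^^ m) x \<bullet> y"
  by (induction m arbitrary: x y) (auto simp: sym funpow_swap1)

text \<open>Moving one \<open>f\<close> across the inner product lowers the exponent by two, hence
  the two base cases 0 and 1.\<close>

lemma psd_funpow: "0 \<le> x \<bullet> (f ^^ m) x"
proof (induction m arbitrary: x rule: induct_nat_012)
  case (ge2 m)
  have "x \<bullet> (f ^^ Suc (Suc m)) x = f x \<bullet> (f ^^ m) (f x)"
    by (simp add: sym[symmetric] funpow_swap1)
  then show ?case
    using ge2.IH(1) by simp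
qed (auto simp: psd)

text \<open>Cauchy-Schwarz for the form of \<open>f ^^ m\<close>, applied to \<open>x\<close> and
  \<open>f x\<close>.\<close>

lemma moment_log_convex:
  "(x \<bullet> (f ^^ Suc m) x)\<^sup>2 \<le> (x \<bullet> (f ^^ m) x) * (x \<bullet> (f ^^ Suc (Suc m)) x)"
proof -
  have "(x \<bullet> (f ^^ m) (f x))\<^sup>2 \<le> (x \<bullet> (f ^^ m) x) * (f x \<bullet> (f ^^ m) (f x))"
    by (intro psd_Cauchy_Schwarz linear_funpow sym_funpow psd_funpow)
  then show ?thesis
    by (simp add: sym[symmetric] funpow_swap1)
qed

text \<open>If \<open>x \<bullet> f x\<close> is positive, log-convexity makes the ratios of
  consecutive moments nondecreasing; for a unit vector the first ratio is
  \<open>x \<bullet> f x\<close>.\<close>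

lemma moment_ge_power:
  assumes "norm x = 1"
  shows "(x \<bullet> f x) ^ m \<le> x \<bullet> (f ^^ m) x"
proof (cases "x \<bullet> f x = 0")
  case True
  then show ?thesis
    using assms psd_funpow[of x m] by (cases m) (auto simp: dot_square_norm)
next
  case False
  define a where "a m = x \<bullet> (f ^^ m) x" for m
  define c where "c = x \<bullet> f x"
  have c: "0 < c"
    using False psd[of x] by (simp add: c_def)
  \<comment> \<open>Positivity is carried along so that \<open>a m\<close> can be cancelled from the
    log-convexity bound.\<close>
  have step: "0 < a m \<and> c * a m \<le> a (Suc m)" for m
  proof (induction m)
    case 0
    then show ?case
      using assms by (simp add: a_def c_def dot_square_norm)
  next
    case (Suc m)
    have pos: "0 < a (Suc m)"
      using Suc c by (meson mult_pos_pos less_le_trans)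
    have "a m * (c * a (Suc m)) = (c * a m) * a (Suc m)"
      by simp
    also have "\<dots> \<le> (a (Suc m))\<^sup>2"
      using Suc pos by (simp add: power2_eq_square)
    also have "\<dots> \<le> a m * a (Suc (Suc m))"
      unfolding a_def by (rule moment_log_convex)
    finally show ?case
      using Suc pos by simp
  qed
  have "c ^ m \<le> a m"
  proof (induction m)
    case 0
    then show ?case
      using assms by (simp add: a_def dot_square_norm)
  next
    case (Suc m)
    have "c ^ Suc m \<le> c * a m"
      using Suc c by simp
    then show ?case
      using step[of m] by linarith
  qed
  then show ?thesis
    by (simp add: a_def c_def)
qed

end

section \<open>Positive semidefinite matrices: sums, diagonal entries and traces\<close>

lemma psd_matrix_inner_commute:
  "psd_matrix M \<Longrightarrow> x \<bullet> (M *v y) = (M *v x) \<bullet> y"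
  by (metis dot_lmul_matrix psd_matrix_def transpose_matrix_vector)

lemma psd_matrix_sum:
  assumes "\<And>i. i \<in> I \<Longrightarrow> psd_matrix (A i)"
  shows "psd_matrix (\<Sum>i\<in>I. A i)"
  using assms
proof (induction I rule: infinite_finite_induct)
  case (insert a I)
  then show ?case
    by (auto simp: psd_matrix_def transpose_def vec_eq_iff matrix_vector_mult_add_rdistrib inner_add_right)
qed (auto simp: psd_matrix_def transpose_def vec_eq_iff)

lemma inner_axis_matrix: "axis i 1 \<bullet> ((M::real^'d^'d) *v axis j 1) = M $ i $ j"
  by (simp add: inner_axis' matrix_vector_mult_basis column_def)

lemma trace_sum: "trace (\<Sum>i\<in>I. A i) = (\<Sum>i\<in>I. trace (A i :: real^'d^'d))"
  unfolding trace_def sum_component by (rule sum.swap)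

lemma psd_matrix_diag_nonneg: "psd_matrix M \<Longrightarrow> 0 \<le> M $ i $ i"
  by (metis inner_axis_matrix psd_matrix_def)

lemma psd_matrix_trace_nonneg: "psd_matrix M \<Longrightarrow> 0 \<le> trace M"
  by (simp add: trace_def sum_nonneg psd_matrix_diag_nonneg)

section \<open>The spectral norm\<close>

lemma spectral_norm_nonneg: "0 \<le> spectral_norm M"
  by (simp add: spectral_norm_def onorm_pos_le)

lemma norm_matrix_vector_le: "norm (M *v x) \<le> spectral_norm M * norm x"
  unfolding spectral_norm_def by (rule onorm) simp

lemma spectral_norm_mult: "spectral_norm (M ** N) \<le> spectral_norm M * spectral_norm N"
  using onorm_compose[of "(*v) M" "(*v) N"]
  by (simp add: spectral_norm_def o_def matrix_vector_mul_assoc)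

lemma spectral_norm_scaleR: "spectral_norm (r *\<^sub>R M) = \<bar>r\<bar> * spectral_norm M"
  by (simp add: spectral_norm_def scaleR_matrix_vector_assoc[symmetric] onorm_scaleR)

lemma sum_matrix_vector: "(\<Sum>i\<in>I. A i) *v x = (\<Sum>i\<in>I. (A i :: real^'n^'m) *v x)"
  by (induction I rule: infinite_finite_induct) (auto simp: matrix_vector_mult_add_rdistrib)

lemma spectral_norm_sum:
  "finite I \<Longrightarrow> spectral_norm (\<Sum>i\<in>I. A i) \<le> (\<Sum>i\<in>I. spectral_norm (A i))"
  unfolding spectral_norm_def sum_matrix_vector by (rule onorm_sum) auto

text \<open>
  Cauchy--Schwarz for the form of \<open>M\<close> gives \<open>(M x)\<^sub>i\<^sup>2 \<le> M\<^sub>i\<^sub>i (x \<bullet> M x)\<close>; summing over \<open>i\<close> yields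
  \<open>\<parallel>M x\<parallel>\<^sup>2 \<le> trace M \<cdot> \<parallel>x\<parallel> \<parallel>M x\<parallel>\<close>.
\<close>

lemma spectral_norm_le_trace:
  fixes M :: "real^'d^'d"
  assumes "psd_matrix M"
  shows "spectral_norm M \<le> trace M"
  unfolding spectral_norm_def
proof (rule onorm_bound)
  fix x :: "real^'d"
  have "((M *v x) $ i)\<^sup>2 \<le> M $ i $ i * (x \<bullet> (M *v x))" for i
  proof -
    have "(axis i 1 \<bullet> (M *v x))\<^sup>2 \<le> (axis i 1 \<bullet> (M *v axis i 1)) * (x \<bullet> (M *v x))"
      using assms by (intro psd_Cauchy_Schwarz psd_matrix_inner_commute matrix_vector_mul_linear)
        (auto simp: psd_matrix_def)
    then show ?thesis
      by (simp only: inner_axis_matrix) (simp add: inner_axis')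
  qed
  then have "(norm (M *v x))\<^sup>2 \<le> (\<Sum>i\<in>UNIV. M $ i $ i * (x \<bullet> (M *v x)))"
    unfolding power2_norm_eq_inner inner_vec_def
    by (intro sum_mono) (simp add: power2_eq_square)
  also have "\<dots> = trace M * (x \<bullet> (M *v x))"
    by (simp add: trace_def sum_distrib_right)
  also have "\<dots> \<le> trace M * (norm x * norm (M *v x))"
    by (intro mult_left_mono norm_cauchy_schwarz psd_matrix_trace_nonneg assms)
  finally have "norm (M *v x) * norm (M *v x) \<le> (trace M * norm x) * norm (M *v x)"
    by (simp add: power2_eq_square algebra_simps)
  \<comment> \<open>Cancel \<open>norm (M *v x)\<close>; if it is zero, nonnegativity of the trace
    suffices.\<close>
  then show "norm (M *v x) \<le> trace M * norm x"
    using psd_matrix_trace_nonneg[OF assms]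
    by (cases "M *v x = 0") auto
qed (rule psd_matrix_trace_nonneg[OF assms])

section \<open>Norms and traces of products and powers\<close>

lemma spectral_norm_mat_prod_le:
  assumes "\<And>M. M \<in> set Ms \<Longrightarrow> psd_matrix M"
  shows "spectral_norm (mat_prod Ms) \<le> prod_list (map trace Ms)"
  using assms
proof (induction Ms)
  case Nil
  then show ?case
    by (simp add: spectral_norm_def onorm_id_le)
next
  case (Cons M Ms)
  have "spectral_norm (mat_prod (M # Ms)) \<le> spectral_norm (mat_prod Ms) * spectral_norm M"
    by (simp add: spectral_norm_mult)
  also have "\<dots> \<le> prod_list (map trace Ms) * trace M"
    using Cons by (intro mult_mono spectral_norm_le_trace prod_list_nonneg spectral_norm_nonneg)
      (auto intro: psd_matrix_trace_nonneg)
  finally show ?case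
    by (simp add: mult.commute)
qed

text \<open>\<open>T\<close> is the \<open>k\<close>-th power of \<open>S\<close>, given by its
  action. The largest diagonal entry of \<open>S\<close> is at least the mean one, and its
  \<open>k\<close>-th power is at most the matching diagonal entry of \<open>T\<close>.\<close>

lemma trace_power_le:
  fixes S :: "real^'d^'d"
  assumes psd: "psd_matrix S" and T: "\<And>x. T *v x = (((*v) S) ^^ k) x"
  shows "trace S ^ k \<le> real CARD('d) ^ k * spectral_norm T"
proof -
  define r where "r = Max (range (\<lambda>i. S $ i $ i))"
  have "r \<in> range (\<lambda>i. S $ i $ i)"
    unfolding r_def by (rule Max_in) auto
  then obtain j where j: "r = S $ j $ j"
    by blast
  have "trace S \<le> (\<Sum>i\<in>(UNIV::'d set). r)"
    unfolding trace_def r_def by (intro sum_mono Max_ge) auto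
  then have "trace S ^ k \<le> (real CARD('d) * r) ^ k"
    using psd_matrix_trace_nonneg[OF psd] by (intro power_mono) auto
  also have "r ^ k \<le> spectral_norm T"
  proof -
    let ?e = "axis j 1 :: real^'d"
    have "r ^ k = (?e \<bullet> (S *v ?e)) ^ k"
      by (simp only: inner_axis_matrix j)
    also have "\<dots> \<le> ?e \<bullet> (T *v ?e)"
      unfolding T using psd
      by (intro moment_ge_power psd_matrix_inner_commute matrix_vector_mul_linear)
        (auto simp: psd_matrix_def)
    also have "\<dots> \<le> norm ?e * norm (T *v ?e)"
      by (rule norm_cauchy_schwarz)
    also have "\<dots> \<le> spectral_norm T"
      using norm_matrix_vector_le[of T ?e] by simp
    finally show ?thesis .
  qed
  then have "(real CARD('d) * r) ^ k \<le> real CARD('d) ^ k * spectral_norm T"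
    by (simp add: power_mult_distrib mult_left_mono)
  finally show ?thesis .
qed

text \<open>Expanding the \<open>k\<close>-th power of the sum yields one product per list of
  indices, repetitions allowed.\<close>

lemma sum_mat_prod_lists:
  fixes A :: "'i \<Rightarrow> real^'d^'d"
  assumes "finite I"
  shows "(\<Sum>l | length l = k \<and> set l \<subseteq> I. mat_prod (map A l)) *v x = (((*v) (\<Sum>i\<in>I. A i)) ^^ k) x"
proof (induction k arbitrary: x)
  case 0
  have "{l. length l = 0 \<and> set l \<subseteq> I} = {[]}"
    by auto
  then show ?case by simp
next
  case (Suc k)
  let ?L = "\<lambda>k. {l. set l \<subseteq> I \<and> length l = k}"
  let ?S = "\<Sum>i\<in>I. A i"
  have IH: "(\<Sum>l\<in>?L k. mat_prod (map A l)) *v y = ((*v) ?S ^^ k) y" for y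
    using Suc by (simp add: conj_commute)
  have inj: "inj_on (\<lambda>(xs, n). n # xs) (?L k \<times> I)"
    by (auto simp: inj_on_def)
  \<comment> \<open>The head of a list is the rightmost factor, so it acts on \<open>x\<close>
    first.\<close>
  have "(\<Sum>l\<in>?L (Suc k). mat_prod (map A l)) *v x
      = (\<Sum>(l, i)\<in>?L k \<times> I. mat_prod (map A l) ** A i) *v x"
    unfolding lists_length_Suc_eq sum.reindex[OF inj]
    by (simp add: case_prod_unfold)
  also have "\<dots> = (\<Sum>l\<in>?L k. \<Sum>i\<in>I. mat_prod (map A l) *v (A i *v x))"
    by (simp add: sum_matrix_vector sum.cartesian_product case_prod_unfold matrix_vector_mul_assoc)
  also have "\<dots> = (\<Sum>l\<in>?L k. mat_prod (map A l)) *v (?S *v x)"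
    unfolding sum_matrix_vector by (simp add: linear_sum[OF matrix_vector_mul_linear])
  also have "\<dots> = ((*v) ?S ^^ Suc k) x"
    unfolding IH by (simp add: funpow_swap1)
  finally show ?case
    by (simp add: conj_commute)
qed

section \<open>Comparison of the two expectations\<close>

theorem proposition3p4:
  fixes A :: "nat \<Rightarrow> real^'d^'d" and n k :: nat
  assumes psd: "\<And>i. i \<in> {1..n} \<Longrightarrow> psd_matrix (A i)"
    and k: "1 \<le> k" "k \<le> n"
  shows "spectral_norm (expectation_wo n k A mat_prod)
           \<le> real CARD('d) ^ k * spectral_norm (expectation_wr n k A mat_prod)"
proof -
  define S where "S = (\<Sum>i\<in>{1..n}. A i)"
  define T where "T = (\<Sum>l | length l = k \<and> set l \<subseteq> {1..n}. mat_prod (map A l))"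
  let ?L = "{l. length l = k \<and> set l \<subseteq> {1..n} \<and> distinct l}"
  define c :: real where "c = fact (n - k) / fact n"
  \<comment> \<open>\<open>c\<close> is the reciprocal of the number of distinct lists; this uses
    \<open>k \<le> n\<close>.\<close>
  have c: "0 \<le> c" "c * (fact k * real (n choose k)) = 1"
    using k by (auto simp: c_def binomial_fact)
  have finL: "finite ?L"
    by (rule finite_subset[OF _ finite_lists_length_eq[of "{1..n}" k]]) auto
  have "spectral_norm (expectation_wo n k A mat_prod)
      = c * spectral_norm (\<Sum>l\<in>?L. mat_prod (map A l))"
    using c by (simp add: expectation_wo_def spectral_norm_scaleR c_def)
  also have "\<dots> \<le> c * (\<Sum>l\<in>?L. prod_list (map (\<lambda>i. trace (A i)) l))"
  proof (intro mult_left_mono c order_trans[OF spectral_norm_sum] sum_mono finL)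
    fix l assume "l \<in> ?L"
    then have "spectral_norm (mat_prod (map A l)) \<le> prod_list (map trace (map A l))"
      by (intro spectral_norm_mat_prod_le) (auto intro!: psd dest: subsetD)
    then show "spectral_norm (mat_prod (map A l)) \<le> prod_list (map (\<lambda>i. trace (A i)) l)"
      by (simp add: o_def)
  qed
  also have "\<dots> = c * (fact k * elem_sym k {1..n} (\<lambda>i. trace (A i)))"
    by (simp only: sum_distinct_lists finite_atLeastAtMost)
  \<comment> \<open>Maclaurin's inequality; by linearity the traces add up to
    \<open>trace S\<close>.\<close>
  also have "\<dots> \<le> c * (fact k * (real (n choose k) * (trace S / real n) ^ k))"
    using Maclaurin_inequality[of "{1..n}" "\<lambda>i. trace (A i)" k]
    by (intro mult_left_mono c) (auto simp: psd psd_matrix_trace_nonneg S_def trace_sum)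
  also have "\<dots> = trace S ^ k / real n ^ k"
    using c(2) by (simp add: power_divide flip: mult.assoc)
  also have "\<dots> \<le> (real CARD('d) ^ k * spectral_norm T) / real n ^ k"
  proof (intro divide_right_mono trace_power_le)
    show "psd_matrix S"
      unfolding S_def by (intro psd_matrix_sum psd)
    show "T *v x = ((*v) S ^^ k) x" for x
      unfolding T_def S_def by (rule sum_mat_prod_lists) simp
  qed simp
  also have "\<dots> = real CARD('d) ^ k * spectral_norm (expectation_wr n k A mat_prod)"
    by (simp add: expectation_wr_def spectral_norm_scaleR T_def)
  finally show ?thesis .
qed

end
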